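(* Let $f:(0,+\infty)\to\mathbb{R}$ be a function such that $f''$ is completely monotonic on $(0,+\infty)$. Then for every $0\le s\le 1$, the functions $$x\mapsto \exp\Big(-\Big(f(x+1)-f(x+s)-(1-s)f'\big(x+\tfrac{1+s}{2}\big)\Big)\Big)$$ and $$x\mapsto \exp\Big(f(x+1)-f(x+s)-\frac{1-s}{2}\big(f'(x+1)+f'(x+s)\big)\Big)$$ are logarithmically completely monotonic on $(0,+\infty)$.
   Context: A function $g$ is completely monotonic on an interval $(a,b)$ if it has derivatives of all orders there and $(-1)^kg^{(k)}(x)\ge 0$ for all $x\in(a,b)$ and all integers $k\ge 0$. A positive function $g$ is logarithmically completely monotonic on an interval if $g=e^{-h}$ with $h'$ completely monotonic on that interval. *)

theory Defs
  imports "HOL-Analysis.Analysis"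
begin

text \<open>The set \<open>I\<close> is meant to be an open interval, bounded or not. A function on \<open>I\<close> is represented
  by a total function; as \<open>I\<close> is open, its values outside \<open>I\<close> do not affect derivatives on \<open>I\<close>.
  Since \<^const>\<open>deriv\<close> is total, existence of each derivative is required explicitly.\<close>

definition completely_monotonic_on :: "real set \<Rightarrow> (real \<Rightarrow> real) \<Rightarrow> bool" where
  "completely_monotonic_on I g \<longleftrightarrow>
     (\<forall>k. \<forall>x\<in>I. (deriv ^^ k) g differentiable (at x)) \<and>
     (\<forall>k. \<forall>x\<in>I. (-1) ^ k * (deriv ^^ k) g x \<ge> 0)"

definition log_completely_monotonic_on :: "real set \<Rightarrow> (real \<Rightarrow> real) \<Rightarrow> bool" where
  "log_completely_monotonic_on I g \<longleftrightarrow>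
     (\<forall>x\<in>I. g x > 0) \<and>
     (\<exists>h. (\<forall>x\<in>I. g x = exp (- h x)) \<and>
          (\<forall>x\<in>I. h differentiable (at x)) \<and>
          completely_monotonic_on I (deriv h))"

end

theory Submission imports Defs begin

text \<open>If \<open>h\<close> is the negative exponent of either function, then \<open>(-1)\<^sup>k h\<^sup>(\<^sup>k\<^sup>+\<^sup>1\<^sup>)(x)\<close> is the error of the
  midpoint rule, respectively of the trapezoidal rule with the opposite sign, for the integral of
  \<open>(-1)\<^sup>k f\<^sup>(\<^sup>k\<^sup>+\<^sup>2\<^sup>)\<close> over \<open>[x + s, x + 1]\<close>. This integrand is convex because its second derivative is
  \<open>(-1)\<^sup>k\<^sup>+\<^sup>2 f\<^sup>(\<^sup>k\<^sup>+\<^sup>4\<^sup>) \<ge> 0\<close>, so both errors are nonnegative by the Hermite--Hadamard inequalities.\<close>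

text \<open>A derivative depends only on values near the point, so on an open set agreement of the
  \<open>k\<close>-th derivative with \<open>P k\<close> passes to the next order. This lets
  explicit formulas stand in for iterated \<open>deriv\<close>.\<close>

lemma higher_deriv_eqI:
  fixes g :: "'a :: real_normed_field \<Rightarrow> 'a"
  assumes "open S" and "\<And>x. x \<in> S \<Longrightarrow> P 0 x = g x"
    and "\<And>k x. x \<in> S \<Longrightarrow> (P k has_field_derivative P (Suc k) x) (at x)"
    and "x \<in> S"
  shows "(deriv ^^ k) g x = P k x"
  using assms(4)
proof (induction k arbitrary: x)
  case 0
  then show ?case by (simp add: assms(2))
next
  case (Suc k)
  have "((deriv ^^ k) g has_field_derivative P (Suc k) x) (at x)"
    using assms(1,3) Suc by (metis has_field_derivative_transform_within_open)
  then show ?case by (simp add: DERIV_imp_deriv)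
qed

lemma completely_monotonic_onI:
  assumes "open S" and "\<And>x. x \<in> S \<Longrightarrow> P 0 x = g x"
    and der: "\<And>k x. x \<in> S \<Longrightarrow> (P k has_real_derivative P (Suc k) x) (at x)"
    and nonneg: "\<And>k x. x \<in> S \<Longrightarrow> (-1) ^ k * P k x \<ge> 0"
  shows "completely_monotonic_on S g"
proof -
  have eq: "(deriv ^^ k) g x = P k x" if "x \<in> S" for k x
    using assms(1-3) that by (rule higher_deriv_eqI)
  have "(deriv ^^ k) g differentiable (at x)" if "x \<in> S" for k x
  proof -
    have "((deriv ^^ k) g has_real_derivative P (Suc k) x) (at x)"
      using der[OF that] assms(1) that eq by (metis has_field_derivative_transform_within_open)
    then show ?thesis by (metis real_differentiable_def)
  qed
  then show ?thesis
    unfolding completely_monotonic_on_def using eq nonneg by simp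
qed

text \<open>The witness for \<open>h\<close> is \<open>P 0\<close>, so \<open>P (Suc k)\<close> is
  the \<open>k\<close>-th derivative of \<open>h'\<close>; hence the sign \<open>(-1) ^ k\<close>
  beside the index \<open>Suc k\<close>.\<close>

lemma log_completely_monotonic_onI:
  assumes "open S"
    and "\<And>k x. x \<in> S \<Longrightarrow> (P k has_real_derivative P (Suc k) x) (at x)"
    and "\<And>k x. x \<in> S \<Longrightarrow> (-1) ^ k * P (Suc k) x \<ge> 0"
    and "\<And>x. x \<in> S \<Longrightarrow> g x = exp (- P 0 x)"
  shows "log_completely_monotonic_on S g"
  unfolding log_completely_monotonic_on_def
proof (intro conjI exI[of _ "P 0"] ballI)
  show "completely_monotonic_on S (deriv (P 0))"
    using assms by (intro completely_monotonic_onI[where P = "\<lambda>k. P (Suc k)"])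
      (auto intro: DERIV_imp_deriv[symmetric])
  show "P 0 differentiable (at x)" if "x \<in> S" for x
    using assms(2)[OF that] by (metis real_differentiable_def)
qed (simp_all add: assms)

text \<open>The interval is grown symmetrically from its midpoint \<open>m\<close>. The error
  \<open>\<phi> t\<close> over \<open>[m - t, m + t]\<close> vanishes at 0, and its derivative
  \<open>G (m + t) + G (m - t) - 2 * G m\<close> is nonnegative by convexity.\<close>

lemma midpoint_rule_le_convex:
  fixes F G :: "real \<Rightarrow> real"
  assumes F: "\<And>x. x \<in> {a..b} \<Longrightarrow> (F has_real_derivative G x) (at x)"
    and G: "convex_on {a..b} G" and "a \<le> b"
  shows "(b - a) * G ((a + b) / 2) \<le> F b - F a"
proof -
  define m d where "m = (a + b) / 2" and "d = (b - a) / 2"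
  have ab: "a = m - d" "b = m + d" "d \<ge> 0"
    using \<open>a \<le> b\<close> by (auto simp: m_def d_def field_simps)
  define \<phi> where "\<phi> t = F (m + t) - F (m - t) - 2 * t * G m" for t
  have "\<phi> 0 \<le> \<phi> d"
  proof (rule DERIV_nonneg_imp_nondecreasing[OF \<open>d \<ge> 0\<close>])
    fix t assume t: "0 \<le> t" "t \<le> d"
    have "(\<phi> has_real_derivative G (m + t) * 1 - G (m - t) * (- 1) - 2 * G m) (at t)"
      unfolding \<phi>_def using t ab
      by (auto intro!: derivative_eq_intros DERIV_chain2[OF F])
    moreover have "G m \<le> (G (m + t) + G (m - t)) / 2"
      using convex_onD[OF G, of "1/2" "m + t" "m - t"] t ab by (simp add: field_simps)
    ultimately show "\<exists>y. (\<phi> has_real_derivative y) (at t) \<and> 0 \<le> y"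
      by (intro exI conjI) auto
  qed
  then show ?thesis
    unfolding \<phi>_def m_def[symmetric] using ab by simp
qed

text \<open>The same growth from the midpoint: when \<open>\<phi>\<close> is differentiated the
  \<open>G\<close> terms cancel, leaving \<open>t * (H (m + t) - H (m - t))\<close>. Convexity of
  \<open>G\<close> therefore enters as monotonicity of its derivative \<open>H\<close>.\<close>

lemma trapezoidal_rule_ge_convex:
  fixes F G H :: "real \<Rightarrow> real"
  assumes F: "\<And>x. x \<in> {a..b} \<Longrightarrow> (F has_real_derivative G x) (at x)"
    and G: "\<And>x. x \<in> {a..b} \<Longrightarrow> (G has_real_derivative H x) (at x)"
    and H: "mono_on {a..b} H" and "a \<le> b"
  shows "F b - F a \<le> (b - a) / 2 * (G b + G a)"
proof -
  define m d where "m = (a + b) / 2" and "d = (b - a) / 2"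
  have ab: "a = m - d" "b = m + d" "d \<ge> 0"
    using \<open>a \<le> b\<close> by (auto simp: m_def d_def field_simps)
  define \<phi> where "\<phi> t = t * (G (m + t) + G (m - t)) - (F (m + t) - F (m - t))" for t
  have "\<phi> 0 \<le> \<phi> d"
  proof (rule DERIV_nonneg_imp_nondecreasing[OF \<open>d \<ge> 0\<close>])
    fix t assume t: "0 \<le> t" "t \<le> d"
    have "(\<phi> has_real_derivative t * (H (m + t) - H (m - t))) (at t)"
      unfolding \<phi>_def using t ab
      by (auto intro!: derivative_eq_intros DERIV_chain2[OF F] DERIV_chain2[OF G]
          simp: algebra_simps)
    moreover have "H (m - t) \<le> H (m + t)"
      using t ab by (intro mono_onD[OF H]) auto
    ultimately show "\<exists>y. (\<phi> has_real_derivative y) (at t) \<and> 0 \<le> y"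
      using t by (metis diff_ge_0_iff_ge mult_nonneg_nonneg)
  qed
  then show ?thesis
    unfolding \<phi>_def using ab by simp
qed

theorem theorem3p2:
  fixes f :: "real \<Rightarrow> real" and s :: real
  assumes "\<And>x. x > 0 \<Longrightarrow> f differentiable (at x)"
    and "\<And>x. x > 0 \<Longrightarrow> deriv f differentiable (at x)"
    and "completely_monotonic_on {0<..} (deriv (deriv f))"
    and "0 \<le> s" and "s \<le> 1"
  shows "log_completely_monotonic_on {0<..}
           (\<lambda>x. exp (- (f (x + 1) - f (x + s) - (1 - s) * deriv f (x + (1 + s) / 2)))) \<and>
         log_completely_monotonic_on {0<..}
           (\<lambda>x. exp (f (x + 1) - f (x + s) - (1 - s) / 2 * (deriv f (x + 1) + deriv f (x + s))))"
proof -
  define D where "D k = (deriv ^^ k) f" for k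
  have D01: "D 0 = f" "D (Suc 0) = deriv f"
    by (simp_all add: D_def)
  have D2: "D (Suc (Suc k)) = (deriv ^^ k) (deriv (deriv f))" for k
    by (simp add: D_def flip: funpow_swap1)
  have diff: "D k differentiable (at x)" if "x > 0" for k x
  proof -
    \<comment> \<open>Complete monotonicity speaks only of derivatives from \<open>f''\<close> on;
      the two lower orders come from the separate differentiability assumptions.\<close>
    consider "k = 0" | "k = 1" | j where "k = Suc (Suc j)"
      by (metis One_nat_def old.nat.exhaust)
    then show ?thesis
      using assms(1-3) that by cases (auto simp: D01 D2 completely_monotonic_on_def)
  qed
  have D: "(D k has_real_derivative D (Suc k) x) (at x)" if "x > 0" for k x
    using diff[OF that, of k] by (simp add: D_def DERIV_deriv_iff_real_differentiable)
  have nonneg: "(-1) ^ k * D (Suc (Suc k)) x \<ge> 0" if "x > 0" for k x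
    using assms(3) that by (simp add: D2 completely_monotonic_on_def)
  \<comment> \<open>Raising the order by two leaves the sign \<open>(-1) ^ k\<close>
    unchanged.\<close>
  note nonneg2 = nonneg[of _ "Suc (Suc _)", simplified]
  \<comment> \<open>All four share the factor \<open>(-1) ^ k\<close> for a fixed \<open>k\<close>,
    so each is exactly the derivative of the one before.\<close>
  define F where "F k x = (-1) ^ k * D (Suc k) x" for k x
  define G where "G k x = (-1) ^ k * D (Suc (Suc k)) x" for k x
  define H where "H k x = (-1) ^ k * D (Suc (Suc (Suc k))) x" for k x
  define K where "K k x = (-1) ^ k * D (Suc (Suc (Suc (Suc k)))) x" for k x
  have FG: "(F k has_real_derivative G k x) (at x)"
    and GH: "(G k has_real_derivative H k x) (at x)"
    and HK: "(H k has_real_derivative K k x) (at x)" if "x > 0" for k x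
    unfolding F_def G_def H_def K_def using that by (auto intro!: DERIV_cmult D)
  have K: "K k x \<ge> 0" if "x > 0" for k x
    unfolding K_def using nonneg2[OF that] .
  have convex: "convex_on {a..b} (G k)" if "0 < a" for a b k
    using that FG GH HK K by (intro f''_ge0_imp_convex[where f' = "H k" and f'' = "K k"]) auto
  have mono: "mono_on {a..b} (H k)" if "0 < a" for a b k
  proof (rule mono_onI)
    fix x y assume "x \<in> {a..b}" "y \<in> {a..b}" "x \<le> y"
    then have "\<exists>l. (H k has_real_derivative l) (at z) \<and> 0 \<le> l" if "x \<le> z" for z
      using HK[of z k] K[of z k] \<open>0 < a\<close> that by auto
    then show "H k x \<le> H k y"
      using \<open>x \<le> y\<close> by (intro DERIV_nonneg_imp_nondecreasing[of x y "H k"]) auto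
  qed
  have D_shift: "((\<lambda>x. D k (x + c)) has_real_derivative D (Suc k) (x + c)) (at x)"
    if "x > 0" "c \<ge> 0" for k x c
    using D[of "x + c" k] that by (simp add: DERIV_shift)
  show ?thesis
  proof
    show "log_completely_monotonic_on {0<..}
           (\<lambda>x. exp (- (f (x + 1) - f (x + s) - (1 - s) * deriv f (x + (1 + s) / 2))))"
    proof (rule log_completely_monotonic_onI[where P = "\<lambda>k x. D k (x + 1) - D k (x + s)
            - (1 - s) * D (Suc k) (x + (1 + s) / 2)"])
      fix k and x :: real assume "x \<in> {0<..}"
      then have x: "x > 0" by simp
      show "((\<lambda>x. D k (x + 1) - D k (x + s) - (1 - s) * D (Suc k) (x + (1 + s) / 2))
          has_real_derivative D (Suc k) (x + 1) - D (Suc k) (x + s)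
            - (1 - s) * D (Suc (Suc k)) (x + (1 + s) / 2)) (at x)"
        using x assms(4,5) by (intro DERIV_diff DERIV_cmult D_shift) auto
      have mid: "(x + s + (x + 1)) / 2 = x + (1 + s) / 2"
        by (simp add: field_simps)
      \<comment> \<open>\<open>F k\<close> is an antiderivative of \<open>G k\<close>, so the
        right-hand side is the integral over \<open>[x + s, x + 1]\<close>, an interval of length
        \<open>1 - s\<close>.\<close>
      have "(x + 1 - (x + s)) * G k ((x + s + (x + 1)) / 2) \<le> F k (x + 1) - F k (x + s)"
        using x assms(4,5) by (intro midpoint_rule_le_convex FG convex) auto
      then show "0 \<le> (-1) ^ k * (D (Suc k) (x + 1) - D (Suc k) (x + s)
            - (1 - s) * D (Suc (Suc k)) (x + (1 + s) / 2))"
        unfolding mid by (simp add: F_def G_def algebra_simps)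
    qed (auto simp: D01)
    show "log_completely_monotonic_on {0<..}
           (\<lambda>x. exp (f (x + 1) - f (x + s) - (1 - s) / 2 * (deriv f (x + 1) + deriv f (x + s))))"
    \<comment> \<open>This exponent carries no minus sign, so \<open>P 0\<close> is its negation:
      trapezoidal value minus integral.\<close>
    proof (rule log_completely_monotonic_onI[where P = "\<lambda>k x.
            (1 - s) / 2 * (D (Suc k) (x + 1) + D (Suc k) (x + s)) - (D k (x + 1) - D k (x + s))"])
      fix k and x :: real assume "x \<in> {0<..}"
      then have x: "x > 0" by simp
      show "((\<lambda>x. (1 - s) / 2 * (D (Suc k) (x + 1) + D (Suc k) (x + s))
            - (D k (x + 1) - D k (x + s)))
          has_real_derivative (1 - s) / 2 * (D (Suc (Suc k)) (x + 1) + D (Suc (Suc k)) (x + s))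
            - (D (Suc k) (x + 1) - D (Suc k) (x + s))) (at x)"
        using x assms(4,5) by (intro DERIV_diff DERIV_add DERIV_cmult D_shift) auto
      \<comment> \<open>The derivative of \<open>G k\<close> does not occur in this inequality;
        supplying \<open>mono\<close> fixes it as \<open>H k\<close>.\<close>
      have "F k (x + 1) - F k (x + s) \<le> (x + 1 - (x + s)) / 2 * (G k (x + 1) + G k (x + s))"
        using x assms(4,5) by (intro trapezoidal_rule_ge_convex[OF _ _ mono[of _ _ k]] FG GH) auto
      then show "0 \<le> (-1) ^ k * ((1 - s) / 2 * (D (Suc (Suc k)) (x + 1) + D (Suc (Suc k)) (x + s))
            - (D (Suc k) (x + 1) - D (Suc k) (x + s)))"
        by (simp add: F_def G_def field_simps)
    qed (auto simp: D01)
  qed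
qed

end
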